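(* Let $n,m\geq 1$ be integers and let $\{a_x\}_{x=0}^\infty$ be the $(n,m)$-bin sequence. Then for all integers $x\geq 2(m+n)$, $$a_x=(m+n+1)\,a_{x-(m+n)}-mn\,a_{x-2(m+n)}.$$
   Context: Fix positive integers $n,m$. The terms $a_0<a_1<a_2<\cdots$ of an increasing sequence of positive integers are divided, in order, into consecutive bins whose sizes alternate $n,m,n,m,\ldots$: the first bin is $\{a_0,\ldots,a_{n-1}\}$, the second is $\{a_n,\ldots,a_{n+m-1}\}$, the third is $\{a_{n+m},\ldots,a_{n+m+n-1}\}$, and so on. Two bins are adjacent if they are consecutive in this ordering. An $(n,m)$-bin legal decomposition of an integer is an expression of it as a sum of terms of the sequence in which no two summands are from the same bin or from adjacent bins. The $(n,m)$-bin sequence is the unique increasing sequence of positive integers $\{a_x\}_{x=0}^\infty$ such that every positive integer has a unique $(n,m)$-bin legal decomposition. (For example, the $(2,3)$-bin sequence begins $1,2,3,4,5,6,9,12,18,24,30,42,\ldots$.) *)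

theory Defs
  imports Main
begin

text \<open>
  Number of the bin containing the index \<open>x\<close>, bins being numbered from \<open>0\<close>. A block of
  \<open>n + m\<close> consecutive indices consists of one bin of size \<open>n\<close> (even number) followed by
  one bin of size \<open>m\<close> (odd number); adjacent bins have consecutive numbers.
\<close>
definition bin_of :: "nat \<Rightarrow> nat \<Rightarrow> nat \<Rightarrow> nat" where
  "bin_of n m x = 2 * (x div (n + m)) + (if x mod (n + m) < n then 0 else 1)"

definition adjacent_bins :: "nat \<Rightarrow> nat \<Rightarrow> bool" where
  "adjacent_bins b c \<longleftrightarrow> c = Suc b \<or> b = Suc c"

text \<open>
  A decomposition is represented by the set \<open>S\<close> of indices of its summands. Sets suffice:
  a repeated summand would give two summands from the same bin.
\<close>
definition bin_legal :: "nat \<Rightarrow> nat \<Rightarrow> nat set \<Rightarrow> bool" where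
  "bin_legal n m S \<longleftrightarrow> finite S \<and>
    (\<forall>i\<in>S. \<forall>j\<in>S. i \<noteq> j \<longrightarrow>
       bin_of n m i \<noteq> bin_of n m j \<and> \<not> adjacent_bins (bin_of n m i) (bin_of n m j))"

definition legal_decomposition :: "nat \<Rightarrow> nat \<Rightarrow> (nat \<Rightarrow> int) \<Rightarrow> int \<Rightarrow> nat set \<Rightarrow> bool" where
  "legal_decomposition n m a k S \<longleftrightarrow> bin_legal n m S \<and> k = (\<Sum>i\<in>S. a i)"

definition is_bin_sequence :: "nat \<Rightarrow> nat \<Rightarrow> (nat \<Rightarrow> int) \<Rightarrow> bool" where
  "is_bin_sequence n m a \<longleftrightarrow>
     strict_mono a \<and> (\<forall>x. 0 < a x) \<and> (\<forall>k>0. \<exists>!S. legal_decomposition n m a k S)"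

end

theory Submission
  imports Defs
begin

text \<open>
  The sums of legal sets of indices below \<open>x\<close> fill exactly the interval from \<open>0\<close> to
  \<open>a x - 1\<close>: by positivity and uniqueness \<open>a x\<close> is the least number that is not such a sum.
  A legal set with greatest element \<open>x\<close> consists of \<open>x\<close> and a legal set of indices below the
  start \<open>p\<close> of the bin preceding that of \<open>x\<close>, so \<open>a (x + 1) = a x + a p\<close>. Hence \<open>a\<close> is an
  arithmetic progression on each bin (including the first index of the next one). Passing from
  one block of \<open>n + m\<close> indices to the next is thus a linear map with trace \<open>m + n + 1\<close> and
  determinant \<open>m n\<close>, and the recurrence is its Cayley-Hamilton identity.
\<close>

section \<open>Bin numbers and the first indices of bins\<close>

lemma bin_of_block:
  assumes "r < n + m"
  shows "bin_of n m (q * (n + m) + r) = 2 * q + (if r < n then 0 else 1)"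
proof -
  have "(q * N + r) div N = q" "(q * N + r) mod N = r" if "r < N" for N
    using that by simp_all
  from this[OF assms] show ?thesis by (simp add: bin_of_def)
qed

lemma bin_of_mono:
  assumes "y \<le> x"
  shows "bin_of n m y \<le> bin_of n m x"
proof (cases "y div (n + m) = x div (n + m)")
  case True
  have "y div (n + m) * (n + m) + y mod (n + m) \<le> x div (n + m) * (n + m) + x mod (n + m)"
    using assms by (simp only: div_mult_mod_eq)
  then show ?thesis
    using True by (simp add: bin_of_def)
next
  case False
  with div_le_mono[OF assms, of "n + m"] show ?thesis
    by (simp add: bin_of_def)
qed

lemma less_even_bin_start_iff:
  assumes "n \<ge> 1"
  shows "y < q * (n + m) \<longleftrightarrow> bin_of n m y < 2 * q"
proof -
  have "y < q * (n + m) \<longleftrightarrow> y div (n + m) < q"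
    using assms by (simp add: div_less_iff_less_mult)
  also have "\<dots> \<longleftrightarrow> bin_of n m y < 2 * q"
    by (auto simp: bin_of_def)
  finally show ?thesis .
qed

lemma less_odd_bin_start_iff:
  assumes "n \<ge> 1" "m \<ge> 1"
  shows "y < q * (n + m) + n \<longleftrightarrow> bin_of n m y < 2 * q + 1"
proof
  assume "y < q * (n + m) + n"
  \<comment> \<open>\<open>q * (n + m) + (n - 1)\<close> is the last index of bin
    \<open>2 * q\<close>.\<close>
  then have "y \<le> q * (n + m) + (n - 1)" by simp
  then have "bin_of n m y \<le> bin_of n m (q * (n + m) + (n - 1))" by (rule bin_of_mono)
  also have "\<dots> = 2 * q" using bin_of_block[of "n - 1" n m q] assms by simp
  finally show "bin_of n m y < 2 * q + 1" by simp
next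
  assume *: "bin_of n m y < 2 * q + 1"
  show "y < q * (n + m) + n"
  proof (rule ccontr)
    assume "\<not> ?thesis"
    then have "q * (n + m) + n \<le> y" by simp
    from bin_of_mono[OF this, of n m] * show False
      using bin_of_block[of n n m q] assms by simp
  qed
qed

section \<open>Sums of legal sets of indices below a bound\<close>

definition legal_sums :: "nat \<Rightarrow> nat \<Rightarrow> (nat \<Rightarrow> int) \<Rightarrow> nat \<Rightarrow> int set" where
  "legal_sums n m a x = sum a ` {S. bin_legal n m S \<and> S \<subseteq> {..<x}}"

lemma legal_sums_0: "legal_sums n m a 0 = {0}"
proof -
  have "{S. bin_legal n m S \<and> S \<subseteq> {..<0}} = {{}}"
    by (auto simp: bin_legal_def)
  then show ?thesis by (simp add: legal_sums_def)
qed

lemma bin_legal_subset: "bin_legal n m S \<Longrightarrow> T \<subseteq> S \<Longrightarrow> bin_legal n m T"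
  unfolding bin_legal_def by (meson finite_subset subsetD)

text \<open>Bin numbers grow with the index, so an index below \<open>x\<close> conflicts with
  \<open>x\<close> only from the bin of \<open>x\<close> or the one before it. Describing
  \<open>p\<close> by bin numbers treats both parities of bins at once.\<close>

lemma bin_legal_insert_top:
  assumes p: "\<And>y. y < p \<longleftrightarrow> Suc (bin_of n m y) < bin_of n m x"
    and T: "T \<subseteq> {..<x}"
  shows "bin_legal n m (insert x T) \<longleftrightarrow> bin_legal n m T \<and> T \<subseteq> {..<p}"
proof
  assume L: "bin_legal n m (insert x T)"
  have "y < p" if "y \<in> T" for y
  proof -
    have "y < x" using that T by auto
    then have "bin_of n m y \<le> bin_of n m x" by (simp add: bin_of_mono)
    moreover have "bin_of n m y \<noteq> bin_of n m x" "bin_of n m x \<noteq> Suc (bin_of n m y)"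
      using L that \<open>y < x\<close> by (auto simp: bin_legal_def adjacent_bins_def)
    ultimately show ?thesis by (simp add: p)
  qed
  then show "bin_legal n m T \<and> T \<subseteq> {..<p}"
    using bin_legal_subset[OF L] by auto
next
  assume R: "bin_legal n m T \<and> T \<subseteq> {..<p}"
  then have "Suc (bin_of n m y) < bin_of n m x" if "y \<in> T" for y
    using that p by auto
  then show "bin_legal n m (insert x T)"
    using R unfolding bin_legal_def adjacent_bins_def by fastforce
qed

lemma legal_sums_Suc:
  assumes p: "\<And>y. y < p \<longleftrightarrow> Suc (bin_of n m y) < bin_of n m x"
  shows "legal_sums n m a (Suc x) = legal_sums n m a x \<union> (+) (a x) ` legal_sums n m a p"
proof -
  \<comment> \<open>At \<open>y = x\<close> the right side of the characterization of
    \<open>p\<close> fails.\<close>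
  have "p \<le> x" using p[of x] by simp
  have top: "sum a S \<in> (+) (a x) ` legal_sums n m a p"
    if "bin_legal n m S" "S \<subseteq> {..<Suc x}" "x \<in> S" for S
  proof -
    define T where "T = S - {x}"
    have T: "T \<subseteq> {..<x}" "S = insert x T" "x \<notin> T"
      using that by (auto simp: T_def less_Suc_eq)
    then have T': "bin_legal n m T" "T \<subseteq> {..<p}"
      using bin_legal_insert_top[OF p T(1)] that by auto
    moreover have "finite T" using T' by (simp add: bin_legal_def)
    ultimately show ?thesis
      using T by (auto simp: legal_sums_def)
  qed
  have "a x + sum a T \<in> legal_sums n m a (Suc x)"
    if "bin_legal n m T" "T \<subseteq> {..<p}" for T
  proof -
    have "T \<subseteq> {..<x}" using that \<open>p \<le> x\<close> by auto
    moreover from this have "bin_legal n m (insert x T)"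
      using bin_legal_insert_top[OF p] that by auto
    moreover have "a x + sum a T = sum a (insert x T)"
      using \<open>T \<subseteq> {..<x}\<close> that by (subst sum.insert) (auto simp: bin_legal_def)
    ultimately show ?thesis
      unfolding legal_sums_def by (intro image_eqI[of _ _ "insert x T"]) auto
  qed
  then have "(+) (a x) ` legal_sums n m a p \<subseteq> legal_sums n m a (Suc x)"
    by (auto simp: legal_sums_def)
  moreover have "legal_sums n m a x \<subseteq> legal_sums n m a (Suc x)"
    by (auto simp: legal_sums_def intro!: imageI)
  moreover have "sum a S \<in> legal_sums n m a x \<union> (+) (a x) ` legal_sums n m a p"
    if "bin_legal n m S" "S \<subseteq> {..<Suc x}" for S
  proof (cases "x \<in> S")
    case True
    then show ?thesis using top[OF that] by blast
  next
    case False
    then have "S \<subseteq> {..<x}" using that by (auto simp: less_Suc_eq)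
    then show ?thesis using that by (auto simp: legal_sums_def)
  qed
  ultimately show ?thesis
    unfolding legal_sums_def[of n m a "Suc x"] by blast
qed

text \<open>If \<open>a x < M\<close>, then \<open>a x\<close> has a second decomposition besides
  \<open>{x}\<close>, using indices below \<open>x\<close>. If \<open>M < a x\<close>, the
  decomposition of \<open>M\<close> has only summands smaller than \<open>a x\<close>, so it lies
  below \<open>x\<close> and \<open>M\<close> is already in the interval.\<close>

lemma bin_sequence_eq_bound:
  assumes a: "is_bin_sequence n m a"
    and V: "legal_sums n m a x = {0..<M}"
  shows "a x = M"
proof (rule antisym)
  have pos: "\<And>i. 0 < a i" and mono: "strict_mono a"
    and uniq: "\<And>k. 0 < k \<Longrightarrow> \<exists>!S. bin_legal n m S \<and> k = sum a S"
    using a by (auto simp: is_bin_sequence_def legal_decomposition_def)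
  \<comment> \<open>Existence of decompositions is available only for positive integers, so
    \<open>0 < M\<close> is needed; the empty set provides it.\<close>
  have "0 \<in> legal_sums n m a x"
    by (auto simp: legal_sums_def bin_legal_def intro!: image_eqI[of _ _ "{}"])
  then have "0 < M" using V by auto
  show "M \<le> a x"
  proof (rule ccontr)
    assume "\<not> M \<le> a x"
    then have "a x \<in> legal_sums n m a x" using V pos[of x] by auto
    then obtain S where S: "bin_legal n m S" "S \<subseteq> {..<x}" "a x = sum a S"
      by (auto simp: legal_sums_def)
    moreover have "bin_legal n m {x}" "a x = sum a {x}" by (auto simp: bin_legal_def)
    ultimately have "S = {x}" using uniq[OF pos[of x]] by blast
    then show False using S by auto
  qed
  show "a x \<le> M"
  proof (rule ccontr)
    assume "\<not> a x \<le> M"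
    obtain S where S: "bin_legal n m S" "M = sum a S" using uniq[OF \<open>0 < M\<close>] by blast
    have "i < x" if "i \<in> S" for i
    proof -
      have "a i \<le> sum a S"
        using S(1) that pos by (intro member_le_sum) (auto simp: bin_legal_def less_imp_le)
      then have "a i < a x" using S \<open>\<not> a x \<le> M\<close> by simp
      then show ?thesis using mono by (simp add: strict_mono_less)
    qed
    then have "M \<in> legal_sums n m a x" using S by (auto simp: legal_sums_def)
    then show False using V by simp
  qed
qed

text \<open>
  For \<open>x\<close> in bin \<open>0\<close> this is \<open>0\<close>; as \<open>a 0 = 1\<close> counts the empty sum alone, the step lemma
  below holds there as well.
\<close>
definition prev_bin_start :: "nat \<Rightarrow> nat \<Rightarrow> nat \<Rightarrow> nat" where
  "prev_bin_start n m x =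
    (let q = x div (n + m) in
     if x mod (n + m) < n then (if q = 0 then 0 else (q - 1) * (n + m) + n) else q * (n + m))"

lemma less_prev_bin_start_iff:
  assumes "n \<ge> 1" "m \<ge> 1"
  shows "y < prev_bin_start n m x \<longleftrightarrow> Suc (bin_of n m y) < bin_of n m x"
proof (cases "x mod (n + m) < n")
  case True
  then show ?thesis
    \<comment> \<open>In block \<open>0\<close> both sides are false; otherwise the preceding bin is
      the odd bin of the previous block.\<close>
    using less_odd_bin_start_iff[OF assms, of y "x div (n + m) - 1"]
    by (cases "x div (n + m)") (auto simp: prev_bin_start_def bin_of_def[of n m x])
next
  case False
  then show ?thesis
    using less_even_bin_start_iff[OF assms(1), of y "x div (n + m)" m]
    by (simp add: prev_bin_start_def bin_of_def[of n m x] Let_def)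
qed

lemma legal_sums_bin_sequence:
  assumes nm: "n \<ge> 1" "m \<ge> 1" and a: "is_bin_sequence n m a"
  shows "legal_sums n m a x = {0..<a x}"
proof (induction x rule: less_induct)
  case (less x)
  \<comment> \<open>Any right endpoint will do, since \<open>bin_sequence_eq_bound\<close>
    identifies it as \<open>a x\<close>.\<close>
  have "\<exists>M. legal_sums n m a x = {0..<M}"
  proof (cases x)
    case 0
    then have "legal_sums n m a x = {0..<1}" by (auto simp: legal_sums_0)
    then show ?thesis ..
  next
    case (Suc z)
    let ?p = "prev_bin_start n m z"
    have "?p \<le> z" using less_prev_bin_start_iff[OF nm, of z z] by simp
    then have IH: "legal_sums n m a z = {0..<a z}" "legal_sums n m a ?p = {0..<a ?p}"
      using less Suc by auto
    have pos: "0 < a z" "0 < a ?p" using a by (auto simp: is_bin_sequence_def)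
    \<comment> \<open>The sums that use \<open>z\<close> start exactly where those that avoid it
      end.\<close>
    have "legal_sums n m a x = {0..<a z} \<union> {a z..<a z + a ?p}"
      using legal_sums_Suc[OF less_prev_bin_start_iff[OF nm], of a z] IH Suc
      by (simp add: image_add_atLeastLessThan add.commute)
    also have "\<dots> = {0..<a z + a ?p}" using pos by auto
    finally show ?thesis ..
  qed
  then show ?case using bin_sequence_eq_bound[OF a] by metis
qed

section \<open>The step formula and its iteration over bins and blocks\<close>

lemma bin_sequence_Suc:
  assumes nm: "n \<ge> 1" "m \<ge> 1" and a: "is_bin_sequence n m a"
  shows "a (Suc x) = a x + a (prev_bin_start n m x)"
proof (rule bin_sequence_eq_bound[OF a])
  have pos: "0 < a x" "0 < a (prev_bin_start n m x)"
    using a by (auto simp: is_bin_sequence_def)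
  have "legal_sums n m a (Suc x) = {0..<a x} \<union> {a x..<a x + a (prev_bin_start n m x)}"
    using legal_sums_Suc[OF less_prev_bin_start_iff[OF nm], of a x]
    by (simp add: legal_sums_bin_sequence[OF assms] image_add_atLeastLessThan add.commute)
  then show "legal_sums n m a (Suc x) = {0..<a x + a (prev_bin_start n m x)}"
    using pos by auto
qed

text \<open>\<open>prev_bin_start\<close> is constant on a bin, so each step adds the same term. The
  case \<open>r = n\<close> reaches the start of the odd bin.\<close>

lemma bin_sequence_even_bin:
  assumes nm: "n \<ge> 1" "m \<ge> 1" and a: "is_bin_sequence n m a" and "r \<le> n"
  shows "a (q * (n + m) + r) =
    a (q * (n + m)) + int r * a (prev_bin_start n m (q * (n + m)))"
  using \<open>r \<le> n\<close>
proof (induction r)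
  case 0
  then show ?case by simp
next
  case (Suc r)
  have "prev_bin_start n m (q * (n + m) + r) = prev_bin_start n m (q * (n + m))"
    using Suc.prems nm by (simp add: prev_bin_start_def)
  then show ?case
    using Suc bin_sequence_Suc[OF nm a, of "q * (n + m) + r"] by (simp add: algebra_simps)
qed

text \<open>Here the preceding bin is the even bin of the same block. The case \<open>j = m\<close>
  reaches the next block.\<close>

lemma bin_sequence_odd_bin:
  assumes nm: "n \<ge> 1" "m \<ge> 1" and a: "is_bin_sequence n m a" and "j \<le> m"
  shows "a (q * (n + m) + n + j) = a (q * (n + m) + n) + int j * a (q * (n + m))"
  using \<open>j \<le> m\<close>
proof (induction j)
  case 0
  then show ?case by simp
next
  case (Suc j)
  have "(q * (n + m) + (n + j)) div (n + m) = q" "(q * (n + m) + (n + j)) mod (n + m) = n + j"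
    using Suc.prems by simp_all
  then have "prev_bin_start n m (q * (n + m) + n + j) = q * (n + m)"
    by (simp add: prev_bin_start_def add.assoc)
  then show ?case
    using Suc bin_sequence_Suc[OF nm a, of "q * (n + m) + n + j"] by (simp add: algebra_simps)
qed

theorem theorem1p1:
  fixes n m :: nat and a :: "nat \<Rightarrow> int"
  assumes "n \<ge> 1" and "m \<ge> 1"
    and "is_bin_sequence n m a"
  shows "\<forall>x \<ge> 2 * (m + n).
    a x = (int m + int n + 1) * a (x - (m + n)) - int m * int n * a (x - 2 * (m + n))"
proof (intro allI impI)
  fix x assume x: "2 * (m + n) \<le> x"
  let ?N = "n + m"
  \<comment> \<open>The pair \<open>(A q, W q)\<close> determines block \<open>q\<close>: its first
    term and the common difference in its even bin.\<close>
  define A where "A q = a (q * ?N)" for q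
  define W where "W q = a (prev_bin_start n m (q * ?N))" for q
  have even: "a (q * ?N + r) = A q + int r * W q" if "r \<le> n" for q r
    using bin_sequence_even_bin[OF assms that] by (simp add: A_def W_def)
  have odd: "a (q * ?N + n + j) = A q + int n * W q + int j * A q" if "j \<le> m" for q j
    using bin_sequence_odd_bin[OF assms that] even[of n q] by (simp add: A_def)
  have W_Suc: "W (Suc q) = A q + int n * W q" for q
  proof -
    have "prev_bin_start n m (Suc q * ?N) = q * ?N + n"
      using assms(1) by (simp add: prev_bin_start_def del: mult_Suc)
    then show ?thesis using even[of n q] by (simp add: W_def)
  qed
  \<comment> \<open>With \<open>W_Suc\<close> this is the matrix with rows \<open>(m + 1, n)\<close>
    and \<open>(1, n)\<close>: trace \<open>m + n + 1\<close>, determinant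
    \<open>(m + 1) * n - n = m * n\<close>.\<close>
  have A_Suc: "A (Suc q) = A q + int n * W q + int m * A q" for q
    using odd[of m q] by (simp add: A_def algebra_simps)
  define q where "q = (x - 2 * ?N) div ?N"
  define r where "r = (x - 2 * ?N) mod ?N"
  have "r < ?N" using assms(1) by (simp add: r_def)
  have "x - 2 * ?N = q * ?N + r" unfolding q_def r_def by (rule div_mult_mod_eq[symmetric])
  then have x0: "x - 2 * (m + n) = q * ?N + r" and x1: "x - (m + n) = Suc q * ?N + r"
    and x2: "x = Suc (Suc q) * ?N + r"
    using x by (simp_all add: algebra_simps)
  \<comment> \<open>The three terms have the same offset \<open>r\<close> in consecutive blocks, so
    they are one fixed linear form evaluated at consecutive pairs \<open>(A, W)\<close>; which form
    depends on the bin containing \<open>r\<close>.\<close>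
  have "a (Suc (Suc q) * ?N + r) =
    (int m + int n + 1) * a (Suc q * ?N + r) - int m * int n * a (q * ?N + r)"
  proof (cases "r < n")
    case True
    then have "a (p * ?N + r) = A p + int r * W p" for p
      using even by simp
    then show ?thesis
      by (simp only: A_Suc W_Suc) (simp add: algebra_simps)
  next
    case False
    define j where "j = r - n"
    have j: "r = n + j" "j \<le> m" using False \<open>r < ?N\<close> by (auto simp: j_def)
    have "a (p * ?N + r) = A p + int n * W p + int j * A p" for p
      using odd[OF j(2)] by (simp add: j(1) add.assoc)
    then show ?thesis
      by (simp only: A_Suc W_Suc) (simp add: algebra_simps)
  qed
  then show "a x = (int m + int n + 1) * a (x - (m + n)) - int m * int n * a (x - 2 * (m + n))"
    by (simp only: x0 x1 flip: x2)
qed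

end
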